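(* Let $s$ be a natural number and $r$ an even natural number with $r \leq s$. Then, as elements of $\mathbb{Q}(v,k)$, \[ \sum_{i=0}^{r} (-1)^i \binom{r}{i} h_{s, s-r+i}\, h_{s, s-i} = \frac{r!}{(r/2)!}\cdot \frac{(v-k-s)^{\overline{r/2}}\,(k-s)^{\overline{s-r/2+1}}\,(k-s)^{\overline{s-r+1}}}{(v-2s+1)^{\overline{s}}\,(v-2s+1)^{\overline{s-r/2}}}. \]
   Context: Notation: $x^{\overline{n}} = \prod_{j=0}^{n-1}(x+j)$, with $x^{\overline{0}} = 1$. For $i \in \{0,\dots,s\}$, $h_{s,i} := \frac{(k-s)^{\overline{i+1}}}{(v-2s+1)^{\overline{i}}} \in \mathbb{Q}(v,k)$. *)

theory Defs
  imports
    "HOL-Computational_Algebra.Polynomial"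
    "HOL-Computational_Algebra.Fraction_Field"
begin

text \<open>
  The field \<open>\<rat>(v,k)\<close> is the fraction field of \<open>\<rat>[v][k]\<close>: the inner polynomial variable is \<open>v\<close>,
  the outer one is \<open>k\<close>.
\<close>

type_synonym ratfun = "rat poly poly fract"

definition var_v :: ratfun where
  "var_v = Fract [:[:0, 1:]:] 1"

definition var_k :: ratfun where
  "var_k = Fract [:0, 1:] 1"

text \<open>
  The rising factorial \<open>x (x + 1) \<dots> (x + n - 1)\<close> is \<^const>\<open>pochhammer\<close>. The definition is
  only meant for \<open>i \<le> s\<close>.
\<close>

definition h :: "nat \<Rightarrow> nat \<Rightarrow> ratfun" where
  "h s i = pochhammer (var_k - of_nat s) (i + 1) / pochhammer (var_v - 2 * of_nat s + 1) i"

end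

(*
  Put A = a + m + 1 and B = b + m, where a = k - s, b = v - 2s + 1 and m = s - r. Up to a common
  factor the sum is the well-poised (Dixon) sum
    S_r(A, B) = sum_i (-1)^i binom(r, i) (A)_i (A)_{r-i} / ((B)_i (B)_{r-i}).
  Pascal's rule followed by (r-1-2i) binom(r-1, i) = (r-1) (binom(r-2, i) - binom(r-2, i-1)) turns
  S_r into (B - A) (r - 1) times an alternating sum over binom(r-2, i), whose summand is, up to
  a telescoping part, that of S_{r-2}(A + 1, B + 2). Iterating this recurrence r/2 times gives
  the product.
*)
theory Submission
  imports Defs
begin

section \<open>Alternating binomial sums\<close>

text \<open>Pascal's rule splits each binomial; shifting the index in one half flips its sign and
  leaves a difference of neighbouring values.\<close>

lemma sum_alternating_binomial_Suc:
  fixes f :: "nat \<Rightarrow> 'a::comm_ring_1"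
  shows "(\<Sum>i\<le>Suc n. (- 1) ^ i * of_nat (Suc n choose i) * f i) =
    (\<Sum>i\<le>n. (- 1) ^ i * of_nat (n choose i) * (f i - f (Suc i)))"
proof -
  have "(\<Sum>i\<le>Suc n. (- 1) ^ i * of_nat (Suc n choose i) * f i) =
      f 0 + (\<Sum>i\<le>n. (- 1) ^ Suc i * of_nat (Suc n choose Suc i) * f (Suc i))"
    by (subst sum.atMost_Suc_shift) simp
  also have "(\<Sum>i\<le>n. (- 1) ^ Suc i * of_nat (Suc n choose Suc i) * f (Suc i)) =
      (\<Sum>i\<le>n. (- 1) ^ Suc i * of_nat (n choose Suc i) * f (Suc i)) -
      (\<Sum>i\<le>n. (- 1) ^ i * of_nat (n choose i) * f (Suc i))"
    unfolding sum_subtractf [symmetric] by (intro sum.cong refl) (simp add: algebra_simps)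
  also have "f 0 + (\<dots>) = (\<Sum>i\<le>Suc n. (- 1) ^ i * of_nat (n choose i) * f i) -
      (\<Sum>i\<le>n. (- 1) ^ i * of_nat (n choose i) * f (Suc i))"
    by (subst sum.atMost_Suc_shift [of _ n]) simp
  finally show ?thesis
    by (simp add: sum_subtractf algebra_simps binomial_eq_0)
qed

lemma sum_binomial_absorb_index:
  fixes f :: "nat \<Rightarrow> 'a::comm_semiring_1"
  shows "(\<Sum>i\<le>Suc n. of_nat (Suc n choose i) * of_nat i * f i) =
    of_nat (Suc n) * (\<Sum>i\<le>n. of_nat (n choose i) * f (Suc i))"
proof -
  have *: "of_nat (Suc n choose Suc i) * of_nat (Suc i) = (of_nat (Suc n) * of_nat (n choose i) :: 'a)" for i
    by (metis Suc_times_binomial mult.commute of_nat_mult)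
  show ?thesis
    unfolding sum.atMost_Suc_shift * sum_distrib_left
    by (simp add: mult.assoc)
qed

lemma sum_binomial_absorb_coindex:
  fixes f :: "nat \<Rightarrow> 'a::comm_semiring_1"
  shows "(\<Sum>i\<le>Suc n. of_nat (Suc n choose i) * of_nat (Suc n - i) * f i) =
    of_nat (Suc n) * (\<Sum>i\<le>n. of_nat (n choose i) * f i)"
proof -
  have *: "of_nat (Suc n choose i) * of_nat (Suc n - i) = (of_nat (Suc n) * of_nat (n choose i) :: 'a)" for i
    using binomial_absorb_comp [of "Suc n" i]
    by (metis diff_Suc_1 mult.commute of_nat_mult)
  show ?thesis
    unfolding * by (simp add: sum_distrib_left mult.assoc binomial_eq_0)
qed

text \<open>The two parts of the weight are absorbed into the binomial separately. Only absorbing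
  \<open>i\<close> shifts the index, and the resulting sign change turns the difference into
  \<open>f i + f (Suc i)\<close>.\<close>

lemma sum_alternating_binomial_weighted:
  fixes f :: "nat \<Rightarrow> 'a::comm_ring_1"
  shows "(\<Sum>i\<le>Suc n. (- 1) ^ i * of_nat (Suc n choose i) * ((of_nat (Suc n - i) - of_nat i) * f i)) =
    of_nat (Suc n) * (\<Sum>i\<le>n. (- 1) ^ i * of_nat (n choose i) * (f i + f (Suc i)))"
proof -
  have "(\<Sum>i\<le>Suc n. (- 1) ^ i * of_nat (Suc n choose i) * ((of_nat (Suc n - i) - of_nat i) * f i)) =
      (\<Sum>i\<le>Suc n. of_nat (Suc n choose i) * of_nat (Suc n - i) * ((- 1) ^ i * f i)) -
      (\<Sum>i\<le>Suc n. of_nat (Suc n choose i) * of_nat i * ((- 1) ^ i * f i))"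
    unfolding sum_subtractf [symmetric] by (intro sum.cong refl) (simp only: algebra_simps)
  also have "\<dots> = of_nat (Suc n) * (\<Sum>i\<le>n. (- 1) ^ i * of_nat (n choose i) * (f i + f (Suc i)))"
    unfolding sum_binomial_absorb_index sum_binomial_absorb_coindex
      right_diff_distrib [symmetric] sum_subtractf [symmetric]
    unfolding sum_distrib_left by (intro sum.cong refl) (simp add: algebra_simps)
  finally show ?thesis .
qed

text \<open>Absorbing the weights turns both halves into \<open>n\<close> times a sum of
  \<open>f (Suc i)\<close> over the same binomials, with opposite signs. This identifies the part of
  a summand that may be discarded in the recurrence.\<close>

lemma sum_alternating_binomial_telescope:
  fixes f :: "nat \<Rightarrow> 'a::comm_ring_1"
  shows "(\<Sum>i\<le>n. (- 1) ^ i * of_nat (n choose i) * (of_nat i * f i + of_nat (n - i) * f (Suc i))) = 0"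
proof (cases n)
  case (Suc m)
  have "(\<Sum>i\<le>n. (- 1) ^ i * of_nat (n choose i) * (of_nat i * f i + of_nat (n - i) * f (Suc i))) =
      (\<Sum>i\<le>Suc m. of_nat (Suc m choose i) * of_nat i * ((- 1) ^ i * f i)) +
      (\<Sum>i\<le>Suc m. of_nat (Suc m choose i) * of_nat (Suc m - i) * ((- 1) ^ i * f (Suc i)))"
    unfolding Suc sum.distrib [symmetric] by (intro sum.cong refl) (simp only: algebra_simps)
  also have "\<dots> = 0"
    unfolding sum_binomial_absorb_index sum_binomial_absorb_coindex
      distrib_left [symmetric] sum.distrib [symmetric]
    by simp
  finally show ?thesis .
qed simp

section \<open>Recurrence and closed form of the well-poised sum\<close>

text \<open>Formally this is \<open>pochhammer a n / pochhammer b n\<close> times the terminating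
  hypergeometric series 3F2(-n, a, 1-b-n; 1-a-n, b; 1).\<close>

definition dixon_sum :: "nat \<Rightarrow> 'a::field \<Rightarrow> 'a \<Rightarrow> 'a" where
  "dixon_sum n a b = (\<Sum>i\<le>n. (- 1) ^ i * of_nat (n choose i) *
    (pochhammer a i * pochhammer a (n - i) / (pochhammer b i * pochhammer b (n - i))))"

lemma pochhammer_nonzero:
  fixes b :: "'a::idom"
  assumes "\<And>m. b + of_nat m \<noteq> 0"
  shows "pochhammer b n \<noteq> 0"
  by (induction n) (simp_all add: pochhammer_Suc assms)

lemma dixon_sum_rec:
  fixes a b :: "'a::field"
  assumes b: "\<And>n. b + of_nat n \<noteq> 0"
  shows "dixon_sum (n + 2) a b = (b - a) * of_nat (n + 1) * (2 * b + of_nat (n + 2)) * a /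
    (b * (b + 1))\<^sup>2 * dixon_sum n (a + 1) (b + 2)"
\<comment> \<open>The main argument multiplies by \<open>a\<close> and cancels it at the end. For
  \<open>a = 0\<close> both sides vanish, since one of \<open>i\<close> and \<open>n + 2 - i\<close>
  is positive.\<close>
proof (cases "a = 0")
  case True
  have "pochhammer a i * pochhammer a (n + 2 - i) = 0" if "i \<le> n + 2" for i
    using that True by (auto simp: pochhammer_0_left)
  then have "dixon_sum (n + 2) a b = 0"
    unfolding dixon_sum_def by (intro sum.neutral ballI) (simp del: mult_eq_0_iff)
  then show ?thesis
    using True by simp
next
  case False
  define F where "F i = pochhammer a i * pochhammer a (n + 2 - i) /
    (pochhammer b i * pochhammer b (n + 2 - i))" for i
  \<comment> \<open>\<open>G i\<close> is the common factor of \<open>F i\<close> and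
    \<open>F (Suc i)\<close>: with i + j = n + 1 the cofactors are (a+j)(b+i) and (a+i)(b+j), which
    differ by (b-a)(j-i).\<close>
  define G where "G i = pochhammer a i * pochhammer a (n + 1 - i) /
    (pochhammer b (i + 1) * pochhammer b (n + 2 - i))" for i
  define H where "H i = pochhammer (a + 1) i * pochhammer (a + 1) (n - i) /
    (pochhammer (b + 2) i * pochhammer (b + 2) (n - i))" for i
  \<comment> \<open>The constant that turns the Pochhammer symbols at \<open>a + 1\<close> and
    \<open>b + 2\<close> in \<open>H i\<close> back into symbols at \<open>a\<close> and
    \<open>b\<close>.\<close>
  define c where "c = a\<^sup>2 / (b * (b + 1))\<^sup>2"
  have FG: "F i - F (Suc i) = (b - a) * ((of_nat (Suc n - i) - of_nat i) * G i)" if i: "i \<le> Suc n" for i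
  proof -
    obtain j where j: "Suc n = i + j"
      using le_Suc_ex [OF i] by blast
    have e: "n + 2 - i = Suc j" "n + 2 - Suc i = j" "n + 1 - i = j" "Suc n - i = j"
      using j by auto
    have "F i = (a + of_nat j) * (b + of_nat i) * G i"
      unfolding F_def G_def e using b [of i] by (simp add: pochhammer_Suc)
    moreover have "F (Suc i) = (a + of_nat i) * (b + of_nat j) * G i"
      unfolding F_def G_def e using b [of j] by (simp add: pochhammer_Suc mult_ac)
    ultimately show ?thesis
      unfolding e by (simp add: algebra_simps)
  qed
  \<comment> \<open>With j = n - i this says that (a+i) \<open>G i\<close> + (a+j)
    \<open>G (Suc i)\<close> equals (2b+n+2) \<open>c * H i\<close>. It works because the cofactors
    b+i+1 and b+j+1 add up to 2b+n+2, which does not depend on \<open>i\<close>.\<close>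
  have GH: "a * (G i + G (Suc i)) = (2 * b + of_nat (n + 2)) * (c * H i) -
      (of_nat i * G i + of_nat (n - i) * G (Suc i))" if i: "i \<le> n" for i
  proof -
    obtain j where j: "n = i + j"
      using le_Suc_ex [OF i] by blast
    have e: "n + 2 - i = Suc (Suc j)" "n + 1 - i = Suc j" "n + 2 - Suc i = Suc j"
      "n + 1 - Suc i = j" "n - i = j"
      using j by auto
    have shift1: "a * pochhammer (a + 1) m = pochhammer a (Suc m)" for m
      by (simp add: pochhammer_rec)
    have shift2: "b * (b + 1) * pochhammer (b + 2) m = pochhammer b (Suc (Suc m))" for m
      by (simp add: pochhammer_rec algebra_simps)
    define g where "g = pochhammer a i * pochhammer a j /
      (pochhammer b (Suc (Suc i)) * pochhammer b (Suc (Suc j)))"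
    have "c * H i = (a * pochhammer (a + 1) i) * (a * pochhammer (a + 1) j) /
        ((b * (b + 1) * pochhammer (b + 2) i) * (b * (b + 1) * pochhammer (b + 2) j))"
      unfolding c_def H_def e by (simp add: power2_eq_square mult_ac)
    also have "\<dots> = pochhammer a (Suc i) * pochhammer a (Suc j) /
        (pochhammer b (Suc (Suc i)) * pochhammer b (Suc (Suc j)))"
      unfolding shift1 shift2 ..
    also have "\<dots> = (a + of_nat i) * (a + of_nat j) * g"
      by (simp add: g_def pochhammer_Suc [of a])
    finally have cH: "c * H i = \<dots>" .
    have G1: "G i = (a + of_nat j) * (b + of_nat (Suc i)) * g"
      unfolding G_def g_def e using b [of "Suc i"]
      by (simp add: pochhammer_Suc [of b "Suc i"] pochhammer_Suc [of a j] del: of_nat_Suc)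
    have G2: "G (Suc i) = (a + of_nat i) * (b + of_nat (Suc j)) * g"
      unfolding G_def g_def e using b [of "Suc j"]
      by (simp add: pochhammer_Suc [of b "Suc j"] pochhammer_Suc [of a i] del: of_nat_Suc)
    show ?thesis
      unfolding cH G1 G2 e by (simp add: j algebra_simps)
  qed
  have "dixon_sum (n + 2) a b = (\<Sum>i\<le>Suc (Suc n). (- 1) ^ i * of_nat (Suc (Suc n) choose i) * F i)"
    by (simp add: dixon_sum_def F_def)
  also have "\<dots> = (\<Sum>i\<le>Suc n. (- 1) ^ i * of_nat (Suc n choose i) * (F i - F (Suc i)))"
    by (rule sum_alternating_binomial_Suc)
  also have "\<dots> = (b - a) * (\<Sum>i\<le>Suc n. (- 1) ^ i * of_nat (Suc n choose i) *
      ((of_nat (Suc n - i) - of_nat i) * G i))"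
    unfolding sum_distrib_left by (intro sum.cong refl) (simp only: FG atMost_iff mult.assoc mult.left_commute [of _ "b - a"])
  also have "\<dots> = (b - a) * of_nat (n + 1) *
      (\<Sum>i\<le>n. (- 1) ^ i * of_nat (n choose i) * (G i + G (Suc i)))"
    unfolding sum_alternating_binomial_weighted by (simp add: mult.assoc)
  finally have 1: "dixon_sum (n + 2) a b = \<dots>" .
  have "a * (\<Sum>i\<le>n. (- 1) ^ i * of_nat (n choose i) * (G i + G (Suc i))) =
      (\<Sum>i\<le>n. (- 1) ^ i * of_nat (n choose i) * (a * (G i + G (Suc i))))"
    by (simp add: sum_distrib_left mult_ac)
  also have "\<dots> = (\<Sum>i\<le>n. (- 1) ^ i * of_nat (n choose i) * ((2 * b + of_nat (n + 2)) * (c * H i) -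
      (of_nat i * G i + of_nat (n - i) * G (Suc i))))"
    by (intro sum.cong refl) (simp only: GH atMost_iff)
  also have "\<dots> = (2 * b + of_nat (n + 2)) * c * (\<Sum>i\<le>n. (- 1) ^ i * of_nat (n choose i) * H i)"
    unfolding right_diff_distrib sum_subtractf sum_alternating_binomial_telescope
    by (simp add: sum_distrib_left mult_ac)
  also have "(\<Sum>i\<le>n. (- 1) ^ i * of_nat (n choose i) * H i) = dixon_sum n (a + 1) (b + 2)"
    by (simp add: dixon_sum_def H_def)
  finally have 2: "(\<Sum>i\<le>n. (- 1) ^ i * of_nat (n choose i) * (G i + G (Suc i))) =
      (2 * b + of_nat (n + 2)) * c * dixon_sum n (a + 1) (b + 2) / a"
    using False by (simp add: field_simps)
  show ?thesis
    unfolding 1 2 c_def using False by (simp add: power2_eq_square mult_ac)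
qed

text \<open>Each use of the recurrence raises b - a by one, which builds up
  \<open>pochhammer (b - a) n\<close>. Keeping \<open>fact n\<close> on the left avoids dividing by
  it, so the characteristic of the field is arbitrary.\<close>

lemma dixon_sum_even:
  fixes a b :: "'a::field"
  assumes "\<And>m. b + of_nat m \<noteq> 0"
  shows "of_nat (fact n) * dixon_sum (2 * n) a b = of_nat (fact (2 * n)) *
    (pochhammer (b - a) n * pochhammer a n / (pochhammer b (2 * n) * pochhammer b n))"
  using assms
proof (induction n arbitrary: a b)
  case 0
  then show ?case by (simp add: dixon_sum_def)
next
  case (Suc n)
  have b2: "b + 2 + of_nat m \<noteq> 0" for m
    using Suc.prems [of "m + 2"] by (simp add: add_ac)
  have nz: "pochhammer b m \<noteq> 0" for m
    using Suc.prems by (rule pochhammer_nonzero)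
  have b0: "b \<noteq> 0" "b + 1 \<noteq> 0"
    using Suc.prems [of 0] Suc.prems [of 1] by simp_all
  have shift2: "b * (b + 1) * pochhammer (b + 2) m = pochhammer b (Suc (Suc m))" for m
    by (simp add: pochhammer_rec algebra_simps)
  have P1: "pochhammer (b + 2) (2 * n) = pochhammer b (2 * Suc n) / (b * (b + 1))"
    using b0 by (simp add: shift2 [symmetric])
  \<comment> \<open>The extra factor \<open>b + of_nat (Suc n)\<close> cancels the one in 2b + 2n +
    2 from the recurrence; the remaining 2 goes into \<open>fact (2 * Suc n)\<close>.\<close>
  have P2: "pochhammer (b + 2) n = pochhammer b (Suc n) * (b + of_nat (Suc n)) / (b * (b + 1))"
    using b0 by (simp only: pochhammer_Suc [of b "Suc n", symmetric] shift2 [symmetric]) simp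
  have P3: "pochhammer (b - a) (Suc n) = (b - a) * pochhammer (b + 2 - (a + 1)) n"
    by (simp add: pochhammer_rec algebra_simps)
  have P4: "pochhammer a (Suc n) = a * pochhammer (a + 1) n"
    by (simp add: pochhammer_rec)
  have f: "of_nat (fact (2 * Suc n)) = (2 * of_nat (Suc n) * of_nat (2 * n + 1) * of_nat (fact (2 * n)) :: 'a)"
    by (simp add: algebra_simps)
  have "of_nat (fact (Suc n)) * dixon_sum (2 * Suc n) a b =
      of_nat (Suc n) * (b - a) * of_nat (2 * n + 1) * (2 * (b + of_nat (Suc n))) * a /
        (b * (b + 1))\<^sup>2 * (of_nat (fact n) * dixon_sum (2 * n) (a + 1) (b + 2))"
    using dixon_sum_rec [OF Suc.prems, of "2 * n" a] by (simp add: algebra_simps)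
  also have "\<dots> = of_nat (fact (2 * Suc n)) *
    (pochhammer (b - a) (Suc n) * pochhammer a (Suc n) /
      (pochhammer b (2 * Suc n) * pochhammer b (Suc n)))"
    unfolding Suc.IH [OF b2] f P1 P2 P3 P4
    using b0 Suc.prems [of "Suc n"] nz [of "Suc n"] nz [of "2 * Suc n"]
    by (simp add: divide_simps power2_eq_square del: of_nat_Suc fact_Suc mult_Suc_right)
  finally show ?case .
qed

section \<open>Reduction of the shifted sum to the well-poised sum\<close>

lemma sum_pochhammer_ratio_even:
  fixes a b :: "'a::field"
  assumes "\<And>m. b + of_nat m \<noteq> 0" and "of_nat (fact n) \<noteq> (0 :: 'a)"
  shows "(\<Sum>i\<le>2 * n. (- 1) ^ i * of_nat (2 * n choose i) *
      (pochhammer a (m + i + 1) / pochhammer b (m + i)) *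
      (pochhammer a (m + 2 * n - i + 1) / pochhammer b (m + 2 * n - i))) =
    of_nat (fact (2 * n)) / of_nat (fact n) *
    (pochhammer (b - a - 1) n * pochhammer a (m + n + 1) * pochhammer a (m + 1) /
      (pochhammer b (m + 2 * n) * pochhammer b (m + n)))"
proof -
  \<comment> \<open>The first m + 1 factors above and m factors below do not depend on
    \<open>i\<close> and are pulled out. The one extra factor above makes B - A equal to b - a -
    1.\<close>
  define A B where "A = a + of_nat (m + 1)" and "B = b + of_nat m"
  have pa: "pochhammer a (m + i + 1) = pochhammer a (m + 1) * pochhammer A i" for i
    using pochhammer_product' [of a "m + 1" i] by (simp add: A_def add_ac)
  have pb: "pochhammer b (m + i) = pochhammer b m * pochhammer B i" for i
    using pochhammer_product' [of b m i] by (simp add: B_def)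
  have B: "B + of_nat i \<noteq> 0" for i
    using assms(1) [of "m + i"] by (simp add: B_def add_ac)
  have BA: "b - a - 1 = B - A"
    by (simp add: A_def B_def)
  have "(\<Sum>i\<le>2 * n. (- 1) ^ i * of_nat (2 * n choose i) *
      (pochhammer a (m + i + 1) / pochhammer b (m + i)) *
      (pochhammer a (m + 2 * n - i + 1) / pochhammer b (m + 2 * n - i))) =
      (pochhammer a (m + 1) / pochhammer b m)\<^sup>2 * dixon_sum (2 * n) A B"
    unfolding dixon_sum_def sum_distrib_left
  proof (intro sum.cong refl)
    fix i
    assume "i \<in> {..2 * n}"
    then have e: "m + 2 * n - i = m + (2 * n - i)"
      by simp
    show "(- 1) ^ i * of_nat (2 * n choose i) *
      (pochhammer a (m + i + 1) / pochhammer b (m + i)) *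
      (pochhammer a (m + 2 * n - i + 1) / pochhammer b (m + 2 * n - i)) =
      (pochhammer a (m + 1) / pochhammer b m)\<^sup>2 * ((- 1) ^ i * of_nat (2 * n choose i) *
      (pochhammer A i * pochhammer A (2 * n - i) / (pochhammer B i * pochhammer B (2 * n - i))))"
      unfolding e pa pb by (simp add: power2_eq_square mult_ac)
  qed
  also have "dixon_sum (2 * n) A B = of_nat (fact (2 * n)) / of_nat (fact n) *
    (pochhammer (B - A) n * pochhammer A n / (pochhammer B (2 * n) * pochhammer B n))"
    using dixon_sum_even [OF B, of n A] assms(2) by (metis (no_types) nonzero_mult_div_cancel_left times_divide_eq_left)
  finally show ?thesis
    unfolding pa pb BA by (simp add: power2_eq_square mult_ac)
qed

section \<open>Specialisation to rational functions in v and k\<close>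

lemma of_nat_ratfun_nonzero:
  assumes "n \<noteq> 0"
  shows "of_nat n \<noteq> (0 :: ratfun)"
  using assms by (simp add: of_nat_fract Zero_fract_def eq_fract)

text \<open>This keeps every denominator nonzero when b = v - 2s + 1 is substituted.\<close>

lemma var_v_shift_nonzero: "var_v - 2 * of_nat s + 1 + of_nat m \<noteq> 0"
proof -
  have "var_v - 2 * of_nat s + 1 + of_nat m =
      Fract ([:[:0, 1:]:] + of_nat (m + 1) - of_nat (2 * s)) 1"
  proof -
    have "var_v - 2 * of_nat s + 1 + of_nat m = var_v + of_nat (m + 1) - of_nat (2 * s)"
      by (simp add: algebra_simps)
    then show ?thesis
      unfolding var_v_def of_nat_fract by simp
  qed
  \<comment> \<open>The coefficient of v in the part free of k: the outer index 0 belongs to k, the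
    inner index 1 to v. The integer shifts do not affect it.\<close>
  moreover have "coeff (coeff ([:[:0, 1:]:] + of_nat (m + 1) - of_nat (2 * s) :: rat poly poly) 0) 1 = 1"
    by (simp only: of_nat_poly) simp
  then have "[:[:0, 1:]:] + of_nat (m + 1) - of_nat (2 * s) \<noteq> (0 :: rat poly poly)"
    by (metis coeff_0 zero_neq_one)
  ultimately show ?thesis
    by (simp add: Zero_fract_def eq_fract del: of_nat_Suc of_nat_add)
qed

theorem theorem3p3:
  fixes s r :: nat
  assumes "even r" and "r \<le> s"
  shows "(\<Sum>i = 0..r. (- 1) ^ i * of_nat (r choose i) * h s (s - r + i) * h s (s - i)) =
    of_nat (fact r) / of_nat (fact (r div 2)) *
    (pochhammer (var_v - var_k - of_nat s) (r div 2) *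
      pochhammer (var_k - of_nat s) (s - r div 2 + 1) *
      pochhammer (var_k - of_nat s) (s - r + 1) /
     (pochhammer (var_v - 2 * of_nat s + 1) s *
      pochhammer (var_v - 2 * of_nat s + 1) (s - r div 2)))"
proof -
  obtain n where r: "r = 2 * n"
    using assms(1) by blast
  obtain m where s: "s = m + 2 * n"
    using assms(2) r by (metis add.commute le_Suc_ex)
  have e: "s - r = m" "r div 2 = n" "s - n = m + n"
    using r s by auto
  \<comment> \<open>With b = v - 2s + 1 and a = k - s this is b - a - 1, the base of the first
    rising factorial in the closed form.\<close>
  have d: "var_v - var_k - of_nat s =
      (var_v - 2 * of_nat s + 1) - (var_k - of_nat s) - 1"
    by (simp add: algebra_simps)
  have "of_nat (fact n) \<noteq> (0 :: ratfun)"
    by (rule of_nat_ratfun_nonzero) simp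
  from sum_pochhammer_ratio_even [OF var_v_shift_nonzero [of s] this, of "var_k - of_nat s" m]
  show ?thesis
    unfolding h_def d e atLeast0AtMost
    unfolding r by (simp only: s [symmetric])
qed

end
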